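(* Let $G$ be a finite simple graph, $k$ a positive integer, and $\mathcal{K}=\{P_1,\dots,P_m\}$ ($m\ge 1$) a clique in $\mathcal{B}_k(G)$. Then exactly one of the following holds: (1) $m=3$ and $\mathcal{K}$ is a cyclic $T$-triangle; (2) $m=3$ and $\mathcal{K}$ is a radial $T$-triangle; (3) $m=4$ and $\mathcal{K}$ is a split $T$-tetrahedron; (4) $m=4$ and $\mathcal{K}$ is a fused $T$-tetrahedron; (5) $\mathcal{K}$ is an $S$-clique.
   Context: A stable $k$-partition of $G$ is a multiset $P=\{V_1,\dots,V_k\}$ of $k$ independent sets of $G$ (some possibly empty) that partition $V(G)$. For $v\in V(G)$, $P-v$ denotes $\{V_i\setminus\{v\}:1\le i\le k\}$. The Bell $k$-coloring graph $\mathcal{B}_k(G)$ has vertex set the stable $k$-partitions of $G$, with distinct $P,Q$ adjacent iff $P-v=Q-v$ for some $v\in V(G)$; we then write $P\sim_v Q$ and say $v$ realizes (is responsible for) the edge $PQ$. An $S$-clique is a clique $\{P_1,\dots,P_m\}$ admitting an anchor vertex $u\in V(G)$ with $P_i-u=P_j-u$ for all $i<j$ (i.e. $u$ realizes every edge of the clique; cliques with $m\le 1$ vacuously qualify). A $T$-clique is a clique that is not an $S$-clique. A cyclic $T$-triangle is a $3$-clique $\{P_1,P_2,P_3\}$ whose edges are realized by distinct vertices $v_1,v_2,v_3$ (with $P_1\sim_{v_3}P_2$, $P_2\sim_{v_1}P_3$, $P_3\sim_{v_2}P_1$) such that $P_i$ contains $\{v_i\}$ as a singleton part for $i=1,2,3$.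 A radial $T$-triangle is a $3$-clique $\{P_1,P_2,P_3\}$ whose edges are realized by distinct $v_1,v_2,v_3$ in the same pattern, such that $P_1$ contains $\{v_1,v_2,v_3\}$ as a part. A fused $T$-tetrahedron is a $4$-clique all four of whose triangles are $T$-cliques. A split $T$-tetrahedron is a $4$-clique with exactly three triangles that are $S$-cliques and one triangle that is a $T$-clique.
   Formalization: A cyclic T-triangle is additionally required to be a T-clique; without this "exactly one" fails, e.g. {1},{2},{3}; {1,3},{2},∅; {1,2},{3},∅ on three isolated vertices meets the cyclic conditions but has anchor 1. *)

theory Defs
  imports "HOL-Library.Multiset" "HOL-Library.Ramsey" "HOL-Library.Disjoint_Sets"
begin

definition simple_graph :: "'a set \<Rightarrow> 'a set set \<Rightarrow> bool" where
  "simple_graph V E \<longleftrightarrow> finite V \<and> E \<subseteq> [V]\<^bsup>2\<^esup>"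

definition stable_partition :: "'a set \<Rightarrow> 'a set set \<Rightarrow> nat \<Rightarrow> 'a set multiset \<Rightarrow> bool" where
  "stable_partition V E k P \<longleftrightarrow>
     (\<exists>W :: nat \<Rightarrow> 'a set. P = image_mset W (mset_set {1..k}) \<and>
        (\<forall>i\<in>{1..k}. W i \<subseteq> V \<and> indep (W i) E) \<and>
        disjoint_family_on W {1..k} \<and> (\<Union>i\<in>{1..k}. W i) = V)"

definition del_vertex :: "'a set multiset \<Rightarrow> 'a \<Rightarrow> 'a set multiset" where
  "del_vertex P v = image_mset (\<lambda>A. A - {v}) P"

(* Several vertices may realize the same edge: if P and Q agree except that P has the parts
   {a,b} and {} where Q has {a} and {b}, then both a and b realize PQ. *)
definition realizes :: "'a set \<Rightarrow> 'a \<Rightarrow> 'a set multiset \<Rightarrow> 'a set multiset \<Rightarrow> bool" where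
  "realizes V v P Q \<longleftrightarrow> v \<in> V \<and> P \<noteq> Q \<and> del_vertex P v = del_vertex Q v"

definition bell_verts :: "'a set \<Rightarrow> 'a set set \<Rightarrow> nat \<Rightarrow> 'a set multiset set" where
  "bell_verts V E k = {P. stable_partition V E k P}"

definition bell_edges :: "'a set \<Rightarrow> 'a set set \<Rightarrow> nat \<Rightarrow> 'a set multiset set set" where
  "bell_edges V E k =
     {{P, Q} | P Q. P \<in> bell_verts V E k \<and> Q \<in> bell_verts V E k \<and> (\<exists>v. realizes V v P Q)}"

definition bell_clique :: "'a set \<Rightarrow> 'a set set \<Rightarrow> nat \<Rightarrow> 'a set multiset set \<Rightarrow> bool" where
  "bell_clique V E k K \<longleftrightarrow> finite K \<and> K \<subseteq> bell_verts V E k \<and> clique K (bell_edges V E k)"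

(* The case card K \<le> 1 is separate because a graph without vertices has no anchor to offer. *)
definition S_clique :: "'a set \<Rightarrow> 'a set set \<Rightarrow> nat \<Rightarrow> 'a set multiset set \<Rightarrow> bool" where
  "S_clique V E k K \<longleftrightarrow> bell_clique V E k K \<and>
     (card K \<le> 1 \<or> (\<exists>u\<in>V. \<forall>P\<in>K. \<forall>Q\<in>K. del_vertex P u = del_vertex Q u))"

definition T_clique :: "'a set \<Rightarrow> 'a set set \<Rightarrow> nat \<Rightarrow> 'a set multiset set \<Rightarrow> bool" where
  "T_clique V E k K \<longleftrightarrow> bell_clique V E k K \<and> \<not> S_clique V E k K"

(* Being a T-clique does not follow from the remaining conjuncts: up to common further parts,
   P1 = {v1},{v2},{v3},  P2 = {v1,v3},{v2},{},  P3 = {v1,v2},{v3},{}  satisfy all of them,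
   yet v1 is an anchor, so the triangle is an S-clique. *)
definition cyclic_T_triangle :: "'a set \<Rightarrow> 'a set set \<Rightarrow> nat \<Rightarrow> 'a set multiset set \<Rightarrow> bool" where
  "cyclic_T_triangle V E k K \<longleftrightarrow> T_clique V E k K \<and> card K = 3 \<and>
     (\<exists>P1 P2 P3 v1 v2 v3. K = {P1, P2, P3} \<and> v1 \<noteq> v2 \<and> v2 \<noteq> v3 \<and> v1 \<noteq> v3 \<and>
        realizes V v3 P1 P2 \<and> realizes V v1 P2 P3 \<and> realizes V v2 P3 P1 \<and>
        {v1} \<in># P1 \<and> {v2} \<in># P2 \<and> {v3} \<in># P3)"

definition radial_T_triangle :: "'a set \<Rightarrow> 'a set set \<Rightarrow> nat \<Rightarrow> 'a set multiset set \<Rightarrow> bool" where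
  "radial_T_triangle V E k K \<longleftrightarrow> bell_clique V E k K \<and> card K = 3 \<and>
     (\<exists>P1 P2 P3 v1 v2 v3. K = {P1, P2, P3} \<and> v1 \<noteq> v2 \<and> v2 \<noteq> v3 \<and> v1 \<noteq> v3 \<and>
        realizes V v3 P1 P2 \<and> realizes V v1 P2 P3 \<and> realizes V v2 P3 P1 \<and>
        {v1, v2, v3} \<in># P1)"

definition fused_T_tetrahedron :: "'a set \<Rightarrow> 'a set set \<Rightarrow> nat \<Rightarrow> 'a set multiset set \<Rightarrow> bool" where
  "fused_T_tetrahedron V E k K \<longleftrightarrow> bell_clique V E k K \<and> card K = 4 \<and>
     (\<forall>T \<in> [K]\<^bsup>3\<^esup>. T_clique V E k T)"

definition split_T_tetrahedron :: "'a set \<Rightarrow> 'a set set \<Rightarrow> nat \<Rightarrow> 'a set multiset set \<Rightarrow> bool" where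
  "split_T_tetrahedron V E k K \<longleftrightarrow> bell_clique V E k K \<and> card K = 4 \<and>
     card {T \<in> [K]\<^bsup>3\<^esup>. S_clique V E k T} = 3 \<and> card {T \<in> [K]\<^bsup>3\<^esup>. T_clique V E k T} = 1"

definition exactly_one :: "bool list \<Rightarrow> bool" where
  "exactly_one bs \<longleftrightarrow> (\<exists>!i. i < length bs \<and> bs ! i)"

end

theory Submission
  imports Defs
begin

text \<open>Since the number \<open>k\<close> of parts is fixed, a stable partition is the same as its equivalence
  relation on \<open>V\<close>, and a vertex \<open>v\<close> realizes \<open>PQ\<close> iff the pairs on which the two relations differ form
  a star centred at \<open>v\<close>. The difference sets of a triangle sum to zero over the field with two
  elements; if their three stars have no common centre, they are exactly the three two-edge paths on
  \<open>{v1, v2, v3}\<close>. Outside these three vertices the relations coincide, and on them they are three of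
  the four equivalence relations with an odd number of related pairs: the triangle is cyclic if the
  total relation is missing and radial otherwise. Any further member of the clique can only be one
  of the five equivalence relations on \<open>{v1, v2, v3}\<close>, and the identity and the total relation are
  not adjacent, so there are at most four members. Adding the fourth odd relation gives the fused
  tetrahedron, adding the identity the split one. Finally, a clique all of whose triangles have
  anchors has an anchor, unless it contains a cyclic triangle.\<close>

section \<open>Partitions as equivalence relations\<close>

definition part_rel :: "'a set multiset \<Rightarrow> 'a \<Rightarrow> 'a \<Rightarrow> bool" where
  "part_rel P x y \<longleftrightarrow> (\<exists>A\<in>#P. x \<in> A \<and> y \<in> A)"

text \<open>Relations are predicates on the whole type. The equivalence in the first clause, with
  symmetry and transitivity, confines them to \<open>V\<close>, so they can be compared by plain
  function equality.\<close>

definition equiv_rel :: "'a set \<Rightarrow> ('a \<Rightarrow> 'a \<Rightarrow> bool) \<Rightarrow> bool" where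
  "equiv_rel V R \<longleftrightarrow> (\<forall>x. R x x \<longleftrightarrow> x \<in> V) \<and> (\<forall>x y. R x y \<longrightarrow> R y x) \<and>
     (\<forall>x y z. R x y \<longrightarrow> R y z \<longrightarrow> R x z)"

definition agree_off :: "'a \<Rightarrow> ('a \<Rightarrow> 'a \<Rightarrow> bool) \<Rightarrow> ('a \<Rightarrow> 'a \<Rightarrow> bool) \<Rightarrow> bool" where
  "agree_off u R Q \<longleftrightarrow> (\<forall>x y. x \<noteq> u \<longrightarrow> y \<noteq> u \<longrightarrow> R x y = Q x y)"

text \<open>This much of stability survives the deletion of a vertex: the indices, hence the number
  of parts, stay, while the union need no longer be \<open>V\<close>. Indexing permits several empty
  parts.\<close>

definition disjoint_parts :: "nat \<Rightarrow> 'a set multiset \<Rightarrow> bool" where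
  "disjoint_parts k P \<longleftrightarrow>
     (\<exists>W :: nat \<Rightarrow> 'a set. P = image_mset W (mset_set {1..k}) \<and> disjoint_family_on W {1..k})"

lemma disjoint_parts_del_vertex:
  assumes "disjoint_parts k P"
  shows "disjoint_parts k (del_vertex P v)"
proof -
  obtain W :: "nat \<Rightarrow> 'a set" where W: "P = image_mset W (mset_set {1..k})"
    "disjoint_family_on W {1..k}"
    using assms unfolding disjoint_parts_def by blast
  have "del_vertex P v = image_mset (\<lambda>i. W i - {v}) (mset_set {1..k})"
    by (simp add: W del_vertex_def image_mset.compositionality comp_def)
  moreover have "disjoint_family_on (\<lambda>i. W i - {v}) {1..k}"
    using W(2) unfolding disjoint_family_on_def by blast
  ultimately show ?thesis unfolding disjoint_parts_def by blast
qed

lemma disjoint_parts_disjoint: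
  assumes "disjoint_parts k P" "A \<in># P" "B \<in># P" "x \<in> A" "x \<in> B"
  shows "A = B"
proof -
  obtain W :: "nat \<Rightarrow> 'a set" where W: "P = image_mset W (mset_set {1..k})"
    "disjoint_family_on W {1..k}"
    using assms unfolding disjoint_parts_def by blast
  have "set_mset P = W ` {1..k}" using W(1) by simp
  then obtain i j where ij: "i \<in> {1..k}" "j \<in> {1..k}" "A = W i" "B = W j"
    using assms(2,3) by (metis imageE)
  have "i = j"
  proof (rule ccontr)
    assume "i \<noteq> j"
    then have "W i \<inter> W j = {}" by (rule disjoint_family_onD[OF W(2) ij(1,2)])
    then show False using assms(4,5) ij(3,4) by blast
  qed
  then show ?thesis using ij by simp
qed

lemma disjoint_parts_size: "disjoint_parts k P \<Longrightarrow> size P = k"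
  unfolding disjoint_parts_def by (elim exE conjE) simp

text \<open>A nonempty part carried by two indices would be disjoint from itself; only the empty
  part can be repeated.\<close>

lemma disjoint_parts_count:
  assumes "disjoint_parts k P" "A \<in># P" "A \<noteq> {}"
  shows "count P A = 1"
proof -
  obtain W :: "nat \<Rightarrow> 'a set" where W: "P = image_mset W (mset_set {1..k})"
    "disjoint_family_on W {1..k}"
    using assms unfolding disjoint_parts_def by blast
  have "set_mset P = W ` {1..k}" using W(1) by simp
  then obtain i where i: "i \<in> {1..k}" "W i = A"
    using assms(2) by (metis imageE)
  have uniq: "j = i" if "j \<in> {1..k}" "W j = A" for j
  proof (rule ccontr)
    assume "j \<noteq> i"
    then have "W j \<inter> W i = {}" by (rule disjoint_family_onD[OF W(2) that(1) i(1)])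
    then show False using assms(3) i(2) that(2) by simp
  qed
  have "W -` {A} \<inter> {1..k} = {i}"
    using uniq i by blast
  moreover have "count (mset_set {1..k}) i = 1"
    using i(1) by simp
  ultimately show ?thesis
    by (simp add: W(1) count_image_mset)
qed

lemma disjoint_parts_mem_iff:
  assumes "disjoint_parts k P" "x \<in> A"
  shows "A \<in># P \<longleftrightarrow> A = {y. part_rel P x y}"
proof
  assume "A \<in># P"
  then show "A = {y. part_rel P x y}"
    using disjoint_parts_disjoint[OF assms(1), of A _ x] assms(2) unfolding part_rel_def by blast
next
  assume A: "A = {y. part_rel P x y}"
  then obtain B where "B \<in># P" "x \<in> B" using assms(2) unfolding part_rel_def by blast
  then have "B = A"
    using disjoint_parts_disjoint[OF assms(1), of B _ x] A unfolding part_rel_def by blast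
  then show "A \<in># P" using \<open>B \<in># P\<close> by simp
qed

text \<open>The number of parts being fixed, the relation also determines how many of them are empty.\<close>

lemma disjoint_parts_eqI:
  assumes P: "disjoint_parts k P" and Q: "disjoint_parts k Q" and eq: "part_rel P = part_rel Q"
  shows "P = Q"
proof -
  have mem: "A \<in># P \<longleftrightarrow> A \<in># Q" if "A \<noteq> {}" for A
  proof -
    obtain x where "x \<in> A" using \<open>A \<noteq> {}\<close> by blast
    then show ?thesis
      using disjoint_parts_mem_iff[OF P, of x A] disjoint_parts_mem_iff[OF Q, of x A] eq by simp
  qed
  have ct: "count P A = count Q A" if "A \<noteq> {}" for A
    using mem[OF that] disjoint_parts_count[OF P _ that] disjoint_parts_count[OF Q _ that]
    by (metis not_in_iff)
  have split: "M = filter_mset (\<lambda>A. A \<noteq> {}) M + replicate_mset (count M {}) {}"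
    for M :: "'a set multiset"
    by (rule multiset_eqI) auto
  have f: "filter_mset (\<lambda>A. A \<noteq> {}) P = filter_mset (\<lambda>A. A \<noteq> {}) Q"
    by (rule multiset_eqI) (simp add: ct)
  have size: "size M = size (filter_mset (\<lambda>A. A \<noteq> {}) M) + count M {}" for M :: "'a set multiset"
    using arg_cong[OF split[of M], of size] by simp
  have "size P = size Q" using P Q by (simp add: disjoint_parts_size)
  then have "count P {} = count Q {}"
    using size[of P] size[of Q] f by simp
  then have "filter_mset (\<lambda>A. A \<noteq> {}) P + replicate_mset (count P {}) {} =
      filter_mset (\<lambda>A. A \<noteq> {}) Q + replicate_mset (count Q {}) {}"
    by (simp add: f)
  then show ?thesis
    by (simp only: split[symmetric])
qed

lemma part_rel_del_vertex:
  "part_rel (del_vertex P u) x y \<longleftrightarrow> x \<noteq> u \<and> y \<noteq> u \<and> part_rel P x y"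
  unfolding part_rel_def del_vertex_def by auto

lemma stable_partition_disjoint_parts: "P \<in> bell_verts V E k \<Longrightarrow> disjoint_parts k P"
  unfolding bell_verts_def stable_partition_def disjoint_parts_def by blast

text \<open>Deleting \<open>u\<close> restricts the relation to the pairs avoiding \<open>u\<close>
  and keeps the number of parts, so \<open>disjoint_parts_eqI\<close> applies to the two
  results.\<close>

lemma del_vertex_eq_iff:
  assumes "P \<in> bell_verts V E k" "Q \<in> bell_verts V E k"
  shows "del_vertex P u = del_vertex Q u \<longleftrightarrow> agree_off u (part_rel P) (part_rel Q)"
proof
  assume "del_vertex P u = del_vertex Q u"
  then show "agree_off u (part_rel P) (part_rel Q)"
    unfolding agree_off_def by (metis part_rel_del_vertex)
next
  assume "agree_off u (part_rel P) (part_rel Q)"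
  then have "part_rel (del_vertex P u) = part_rel (del_vertex Q u)"
    unfolding agree_off_def by (auto simp: part_rel_del_vertex fun_eq_iff)
  then show "del_vertex P u = del_vertex Q u"
    by (intro disjoint_parts_eqI[OF assms[THEN stable_partition_disjoint_parts,
          THEN disjoint_parts_del_vertex]])
qed

lemma part_rel_inject:
  assumes "P \<in> bell_verts V E k" "Q \<in> bell_verts V E k"
  shows "part_rel P = part_rel Q \<longleftrightarrow> P = Q"
  using disjoint_parts_eqI[OF assms[THEN stable_partition_disjoint_parts]] by auto

lemma equiv_rel_part_rel:
  assumes "P \<in> bell_verts V E k"
  shows "equiv_rel V (part_rel P)"
proof -
  obtain W :: "nat \<Rightarrow> 'a set" where "P = image_mset W (mset_set {1..k})" "(\<Union>i\<in>{1..k}. W i) = V"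
    using assms unfolding bell_verts_def stable_partition_def by blast
  then have "\<Union> (set_mset P) = V"
    by simp
  then have r: "part_rel P x x \<longleftrightarrow> x \<in> V" for x
    unfolding part_rel_def by auto
  have t: "part_rel P x z" if xy: "part_rel P x y" and yz: "part_rel P y z" for x y z
  proof -
    obtain A B where "A \<in># P" "x \<in> A" "y \<in> A" "B \<in># P" "y \<in> B" "z \<in> B"
      using xy yz unfolding part_rel_def by blast
    moreover from this have "A = B"
      using disjoint_parts_disjoint[OF stable_partition_disjoint_parts[OF assms]] by blast
    ultimately show ?thesis unfolding part_rel_def by blast
  qed
  have s: "part_rel P y x" if "part_rel P x y" for x y
    using that unfolding part_rel_def by blast
  show ?thesis
    unfolding equiv_rel_def by (intro conjI allI impI r) (fact s, fact t)
qed

lemma part_mem_iff: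
  assumes "P \<in> bell_verts V E k" "x \<in> A"
  shows "A \<in># P \<longleftrightarrow> A = {y. part_rel P x y}"
  by (rule disjoint_parts_mem_iff[OF stable_partition_disjoint_parts[OF assms(1)] assms(2)])

lemma agree_off_sym: "agree_off u R Q \<Longrightarrow> agree_off u Q R"
  unfolding agree_off_def by blast

lemma agree_off_refl [simp]: "agree_off u R R"
  unfolding agree_off_def by blast

lemma agree_off_trans: "agree_off u R Q \<Longrightarrow> agree_off u Q S \<Longrightarrow> agree_off u R S"
  unfolding agree_off_def by blast

lemma equiv_relD:
  assumes "equiv_rel V R"
  shows "R x x \<longleftrightarrow> x \<in> V" "R x y \<longleftrightarrow> R y x" "R x y \<Longrightarrow> R y z \<Longrightarrow> R x z"
  using assms unfolding equiv_rel_def by blast+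

section \<open>Equivalence relations that differ by stars\<close>

text \<open>Intended for sets \<open>S\<close> of singleton classes of \<open>B\<close>, which
  become one class. If \<open>S\<close> has at most one element, nothing changes, so the empty set
  represents all these cases later.\<close>

definition join :: "('a \<Rightarrow> 'a \<Rightarrow> bool) \<Rightarrow> 'a set \<Rightarrow> 'a \<Rightarrow> 'a \<Rightarrow> bool" where
  "join B S x y \<longleftrightarrow> B x y \<or> x \<in> S \<and> y \<in> S"

definition isolated3 :: "('a \<Rightarrow> 'a \<Rightarrow> bool) \<Rightarrow> 'a \<Rightarrow> 'a \<Rightarrow> 'a \<Rightarrow> bool" where
  "isolated3 B a b c \<longleftrightarrow> a \<noteq> b \<and> b \<noteq> c \<and> a \<noteq> c \<and>
     (\<forall>x\<in>{a, b, c}. \<forall>y. (B x y \<longleftrightarrow> y = x) \<and> (B y x \<longleftrightarrow> y = x))"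

lemma isolated3D:
  assumes "isolated3 B a b c"
  shows "a \<noteq> b" "b \<noteq> c" "a \<noteq> c"
    and "x \<in> {a, b, c} \<Longrightarrow> B x y \<longleftrightarrow> y = x" "x \<in> {a, b, c} \<Longrightarrow> B y x \<longleftrightarrow> y = x"
  using assms unfolding isolated3_def by blast+

lemma join_eqI:
  assumes R: "equiv_rel V R" and iso: "isolated3 B a b c" and V: "{a, b, c} \<subseteq> V"
    and off: "\<And>x y. x = y \<or> \<not> (x \<in> {a, b, c} \<and> y \<in> {a, b, c}) \<Longrightarrow> R x y = B x y"
    and S: "S \<subseteq> {a, b, c}" "R a b \<longleftrightarrow> a \<in> S \<and> b \<in> S" "R a c \<longleftrightarrow> a \<in> S \<and> c \<in> S"
      "R b c \<longleftrightarrow> b \<in> S \<and> c \<in> S"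
  shows "R = join B S"
proof (intro ext)
  fix x y
  show "R x y = join B S x y"
  proof (cases "x = y \<or> \<not> (x \<in> {a, b, c} \<and> y \<in> {a, b, c})")
    case True
    then have "B x y" if "x \<in> S" "y \<in> S"
      using isolated3D(4)[OF iso, of x y] that S(1) by blast
    then show ?thesis using off[OF True] unfolding join_def by blast
  next
    case False
    then have "\<not> B x y" using isolated3D(4)[OF iso, of x y] by blast
    then show ?thesis using False S(2-4) equiv_relD(2)[OF R] unfolding join_def by blast
  qed
qed

text \<open>A pair on which two of the three relations differ lies in the star of two of the
  realizers, so the relations differ at most on pairs inside \<open>{v1, v2, v3}\<close>. The number of related
  pairs there has the same parity for all three; it cannot be even, since three points carry only
  one equivalence relation with an even number of related pairs.\<close>

lemma triangle_without_anchor: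
  assumes e: "equiv_rel V R1" "equiv_rel V R2" "equiv_rel V R3"
    and a3: "agree_off v3 R1 R2" and a1: "agree_off v1 R2 R3" and a2: "agree_off v2 R3 R1"
    and v: "v1 \<in> V" "v2 \<in> V" "v3 \<in> V"
    and no: "\<And>u. u \<in> V \<Longrightarrow> \<not> (agree_off u R1 R2 \<and> agree_off u R2 R3 \<and> agree_off u R3 R1)"
  shows "\<exists>B. isolated3 B v1 v2 v3 \<and>
    ((R1, R2, R3) = (join B {v2, v3}, join B {v1, v3}, join B {v1, v2}) \<or>
     (R1, R2, R3) = (join B {v1, v2, v3}, join B {v1, v2}, join B {v1, v3}) \<or>
     (R1, R2, R3) = (join B {v1, v2}, join B {v1, v2, v3}, join B {v2, v3}) \<or>
     (R1, R2, R3) = (join B {v1, v3}, join B {v2, v3}, join B {v1, v2, v3}))"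
proof -
  let ?U = "{v1, v2, v3}"
  \<comment> \<open>If two realizers coincided, transitivity would make that vertex an
    anchor.\<close>
  have d: "v1 \<noteq> v2" "v2 \<noteq> v3" "v1 \<noteq> v3"
    using no[OF v(1)] no[OF v(2)] no[OF v(3)] a1 a2 a3
      agree_off_trans[of v1 R2 R3 R1, THEN agree_off_sym]
      agree_off_trans[of v2 R3 R1 R2, THEN agree_off_sym]
      agree_off_trans[of v3 R1 R2 R3, THEN agree_off_sym] by auto
  note s = equiv_relD(2)[OF e(1)] equiv_relD(2)[OF e(2)] equiv_relD(2)[OF e(3)]
  note r = equiv_relD(1)[OF e(1)] equiv_relD(1)[OF e(2)] equiv_relD(1)[OF e(3)]
  note t = equiv_relD(3)[OF e(1)] equiv_relD(3)[OF e(2)] equiv_relD(3)[OF e(3)]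
  have off: "R1 x y = R2 x y \<and> R2 x y = R3 x y" if "x = y \<or> \<not> (x \<in> ?U \<and> y \<in> ?U)" for x y
  proof (cases "x = y")
    case True
    then show ?thesis using r by simp
  next
    case False
    then show ?thesis
      using a1[unfolded agree_off_def, THEN spec, THEN spec, of x y]
        a2[unfolded agree_off_def, THEN spec, THEN spec, of x y]
        a3[unfolded agree_off_def, THEN spec, THEN spec, of x y] that d by auto
  qed
  \<comment> \<open>Each pair inside \<open>?U\<close> avoids the realizer of one edge, so the two
    ends of that edge agree on it.\<close>
  have q: "R1 v1 v3 = R3 v1 v3" "R2 v2 v3 = R3 v2 v3" "R1 v1 v2 = R2 v1 v2"
    using a1 a2 a3 d unfolding agree_off_def by auto
  \<comment> \<open>If the third relation agreed on this pair too, every difference would meet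
    \<open>v3\<close>, which would then be an anchor. The next two facts are analogous.\<close>
  have n12: "R3 v1 v2 \<noteq> R1 v1 v2"
  proof
    assume *: "R3 v1 v2 = R1 v1 v2"
    have "R1 x y = R2 x y \<and> R2 x y = R3 x y" if "x \<noteq> v3" "y \<noteq> v3" for x y
      using off[of x y] that * q s by (metis insertE singletonD)
    then show False using no[OF v(3)] unfolding agree_off_def by blast
  qed
  have n13: "R2 v1 v3 \<noteq> R1 v1 v3"
  proof
    assume *: "R2 v1 v3 = R1 v1 v3"
    have "R1 x y = R2 x y \<and> R2 x y = R3 x y" if "x \<noteq> v2" "y \<noteq> v2" for x y
      using off[of x y] that * q s by (metis insertE singletonD)
    then show False using no[OF v(2)] unfolding agree_off_def by blast
  qed
  have n23: "R1 v2 v3 \<noteq> R2 v2 v3"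
  proof
    assume *: "R1 v2 v3 = R2 v2 v3"
    have "R1 x y = R2 x y \<and> R2 x y = R3 x y" if "x \<noteq> v1" "y \<noteq> v1" for x y
      using off[of x y] that * q s by (metis insertE singletonD)
    then show False using no[OF v(1)] unfolding agree_off_def by blast
  qed
  \<comment> \<open>A class reaching from \<open>x\<close> out to \<open>w\<close> would do so in
    all three relations. Each would then relate \<open>x\<close> and \<open>y\<close> iff it relates
    \<open>y\<close> and \<open>w\<close>, a pair on which they agree; but on no pair inside
    \<open>?U\<close> do all three agree.\<close>
  have sep: "\<not> R1 x w" if "x \<in> ?U" "w \<notin> ?U" for x w
  proof
    assume R: "R1 x w"
    obtain y where y: "y \<in> ?U" "y \<noteq> x" by (metis d(1) insertCI)
    have *: "R1 x w" "R2 x w" "R3 x w" using R off[of x w] that by auto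
    have **: "R1 y w = R2 y w" "R2 y w = R3 y w" using off[of y w] that by auto
    have "R1 x y = R1 y w" "R2 x y = R2 y w" "R3 x y = R3 y w"
      using * s t by metis+
    then have "R1 x y = R2 x y \<and> R2 x y = R3 x y" using ** by simp
    then show False using y that n12 n13 n23 q s by (metis insertE singletonD)
  qed
  define B where "B = (\<lambda>x y. R1 x y \<and> (x = y \<or> \<not> (x \<in> ?U \<and> y \<in> ?U)))"
  have iso: "isolated3 B v1 v2 v3"
    unfolding isolated3_def B_def using d sep s(1) r(1) v by (auto; metis)
  have off1: "R1 x y = B x y" and off2: "R2 x y = B x y" and off3: "R3 x y = B x y"
    if "x = y \<or> \<not> (x \<in> ?U \<and> y \<in> ?U)" for x y
    using off[OF that] that unfolding B_def by blast+
  have "?U \<subseteq> V" using v by simp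
  note J = join_eqI[OF e(1) iso this off1] join_eqI[OF e(2) iso this off2]
    join_eqI[OF e(3) iso this off3]
  have tr: "(R v1 v2 \<and> R v1 v3 \<longrightarrow> R v2 v3) \<and> (R v1 v2 \<and> R v2 v3 \<longrightarrow> R v1 v3) \<and>
      (R v1 v3 \<and> R v2 v3 \<longrightarrow> R v1 v2)" if "equiv_rel V R" for R
    using equiv_relD(2,3)[OF that] by metis
  note tr3 = tr[OF e(1)] tr[OF e(2)] tr[OF e(3)]
  show ?thesis
  proof (rule exI[of _ B], rule conjI[OF iso])
    show "(R1, R2, R3) = (join B {v2, v3}, join B {v1, v3}, join B {v1, v2}) \<or>
     (R1, R2, R3) = (join B {v1, v2, v3}, join B {v1, v2}, join B {v1, v3}) \<or>
     (R1, R2, R3) = (join B {v1, v2}, join B {v1, v2, v3}, join B {v2, v3}) \<or>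
     (R1, R2, R3) = (join B {v1, v3}, join B {v2, v3}, join B {v1, v2, v3})"
    \<comment> \<open>These two values determine everything: \<open>q\<close> and the three
      inequalities carry them to \<open>R2\<close> and \<open>R3\<close>, and transitivity of one of
      the relations settles the pair \<open>v2\<close>, \<open>v3\<close>.\<close>
    proof (cases "R1 v1 v2"; cases "R1 v1 v3")
      assume *: "R1 v1 v2" "R1 v1 v3"
      have vals: "R1 v1 v2" "R1 v1 v3" "R1 v2 v3"
        "R2 v1 v2" "\<not> R2 v1 v3" "\<not> R2 v2 v3"
        "\<not> R3 v1 v2" "R3 v1 v3" "\<not> R3 v2 v3"
        using * n12 n13 n23 q tr3 by blast+
      have "R1 = join B {v1, v2, v3}" "R2 = join B {v1, v2}" "R3 = join B {v1, v3}"
        by (rule J; simp add: vals d d[symmetric])+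
      then show ?thesis by simp
    next
      assume *: "R1 v1 v2" "\<not> R1 v1 v3"
      have vals: "R1 v1 v2" "\<not> R1 v1 v3" "\<not> R1 v2 v3"
        "R2 v1 v2" "R2 v1 v3" "R2 v2 v3"
        "\<not> R3 v1 v2" "\<not> R3 v1 v3" "R3 v2 v3"
        using * n12 n13 n23 q tr3 by blast+
      have "R1 = join B {v1, v2}" "R2 = join B {v1, v2, v3}" "R3 = join B {v2, v3}"
        by (rule J; simp add: vals d d[symmetric])+
      then show ?thesis by simp
    next
      assume *: "\<not> R1 v1 v2" "R1 v1 v3"
      have vals: "\<not> R1 v1 v2" "R1 v1 v3" "\<not> R1 v2 v3"
        "\<not> R2 v1 v2" "\<not> R2 v1 v3" "R2 v2 v3"
        "R3 v1 v2" "R3 v1 v3" "R3 v2 v3"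
        using * n12 n13 n23 q tr3 by blast+
      have "R1 = join B {v1, v3}" "R2 = join B {v2, v3}" "R3 = join B {v1, v2, v3}"
        by (rule J; simp add: vals d d[symmetric])+
      then show ?thesis by simp
    next
      assume *: "\<not> R1 v1 v2" "\<not> R1 v1 v3"
      have vals: "\<not> R1 v1 v2" "\<not> R1 v1 v3" "R1 v2 v3"
        "\<not> R2 v1 v2" "R2 v1 v3" "\<not> R2 v2 v3"
        "R3 v1 v2" "\<not> R3 v1 v3" "\<not> R3 v2 v3"
        using * n12 n13 n23 q tr3 by blast+
      have "R1 = join B {v2, v3}" "R2 = join B {v1, v3}" "R3 = join B {v1, v2}"
        by (rule J; simp add: vals d d[symmetric])+
      then show ?thesis by simp
    qed
  qed
qed

text \<open>Both relations contain \<open>B\<close>, so they can differ only on the three pairs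
  inside \<open>{a, b, c}\<close>. Adjacency of shapes thus becomes a propositional check.\<close>

lemma agree_off_join_iff:
  assumes iso: "isolated3 B a b c" and S: "S \<subseteq> {a, b, c}" "S' \<subseteq> {a, b, c}"
  shows "agree_off u (join B S) (join B S') \<longleftrightarrow>
    (a \<noteq> u \<and> b \<noteq> u \<longrightarrow> (a \<in> S \<and> b \<in> S \<longleftrightarrow> a \<in> S' \<and> b \<in> S')) \<and>
    (b \<noteq> u \<and> c \<noteq> u \<longrightarrow> (b \<in> S \<and> c \<in> S \<longleftrightarrow> b \<in> S' \<and> c \<in> S')) \<and>
    (a \<noteq> u \<and> c \<noteq> u \<longrightarrow> (a \<in> S \<and> c \<in> S \<longleftrightarrow> a \<in> S' \<and> c \<in> S'))" (is "?L \<longleftrightarrow> ?R")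
proof
  have J: "join B X x y \<longleftrightarrow> x \<in> X \<and> y \<in> X" if "x \<in> {a, b, c}" "y \<noteq> x" for X x y
    using isolated3D(4)[OF iso that(1), of y] that(2) unfolding join_def by blast
  show ?R if L: ?L
  proof -
    have "p \<in> S \<and> q \<in> S \<longleftrightarrow> p \<in> S' \<and> q \<in> S'"
      if "p \<in> {a, b, c}" "p \<noteq> q" "p \<noteq> u" "q \<noteq> u" for p q
      using L that J[of p q] unfolding agree_off_def by metis
    then show ?thesis using isolated3D(1-3)[OF iso] by simp
  qed
  show ?L if R: ?R
    unfolding agree_off_def
  proof (intro allI impI)
    fix x y assume xy: "x \<noteq> u" "y \<noteq> u"
    show "join B S x y = join B S' x y"
    proof (cases "x \<in> {a, b, c} \<and> y \<in> {a, b, c} \<and> x \<noteq> y")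
      case True
      then have "x \<in> S \<and> y \<in> S \<longleftrightarrow> x \<in> S' \<and> y \<in> S'" using R xy by blast
      then show ?thesis using True J by metis
    next
      case False
      then have "(x \<in> X \<and> y \<in> X \<longrightarrow> B x y)" if "X \<subseteq> {a, b, c}" for X
        using that isolated3D(4)[OF iso, of x y] by blast
      then show ?thesis using S unfolding join_def by blast
    qed
  qed
qed

text \<open>Outside \<open>{a, b, c}\<close> the relation \<open>Q\<close> cannot deviate from \<open>B\<close>: a deviating pair would be met by
  the centres of all stars, while inside every pair of \<open>{a, b, c}\<close> there must be a centre too.\<close>

lemma agree_off_triangle:
  assumes Q: "equiv_rel V Q" and iso: "isolated3 B a b c" and V: "{a, b, c} \<subseteq> V"
    and B: "\<And>x. B x x \<longleftrightarrow> x \<in> V"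
    and F: "F \<subseteq> Pow {a, b, c}" "\<And>S. S \<in> F \<Longrightarrow> \<exists>u. agree_off u Q (join B S)"
    and pairs: "\<And>x y. x \<in> {a, b, c} \<Longrightarrow> y \<in> {a, b, c} \<Longrightarrow> x \<noteq> y \<Longrightarrow>
      (\<exists>S\<in>F. x \<in> S \<and> y \<in> S) \<and> (\<exists>S\<in>F. \<not> (x \<in> S \<and> y \<in> S))"
  shows "\<exists>S\<in>{{}, {a, b}, {b, c}, {a, c}, {a, b, c}}. Q = join B S"
proof -
  note d = isolated3D(1-3)[OF iso]
  have off: "Q x y = B x y" if "x = y \<or> \<not> (x \<in> {a, b, c} \<and> y \<in> {a, b, c})" for x y
  proof (rule ccontr)
    assume neq: "Q x y \<noteq> B x y"
    then have xy: "x \<noteq> y" using B equiv_relD(1)[OF Q] by blast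
    \<comment> \<open>By \<open>pairs\<close>, some \<open>S\<close> in \<open>F\<close> contradicts
      \<open>Q\<close> on \<open>p\<close>, \<open>q\<close>. As \<open>Q\<close> and
      \<open>join B S\<close> also differ on \<open>x\<close>, \<open>y\<close>, the centre of their
      star lies on both pairs.\<close>
    have meet: "x = p \<or> x = q \<or> y = p \<or> y = q"
      if "p \<in> {a, b, c}" "q \<in> {a, b, c}" "p \<noteq> q" for p q
    proof -
      have "\<exists>S\<in>F. Q p q \<noteq> (p \<in> S \<and> q \<in> S)"
        using pairs[OF that] by (cases "Q p q") auto
      then obtain S where S: "S \<in> F" "Q p q \<noteq> (p \<in> S \<and> q \<in> S)" by blast
      then have pq: "Q p q \<noteq> join B S p q"
        using isolated3D(4)[OF iso that(1), of q] that(3) unfolding join_def by blast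
      have "Q x y \<noteq> join B S x y"
        using neq \<open>x = y \<or> _\<close> xy F(1) S(1) unfolding join_def by blast
      moreover obtain u where "agree_off u Q (join B S)" using F(2)[OF S(1)] by blast
      ultimately show ?thesis using pq unfolding agree_off_def by metis
    qed
    \<comment> \<open>A pair that meets all three sides of a triangle is itself a side, but
      \<open>x\<close>, \<open>y\<close> was assumed not to be one.\<close>
    show False
      using meet[of a b] meet[of b c] meet[of a c] d that xy by auto
  qed
  note J = join_eqI[OF Q iso V off]
  have sym: "Q x y \<longleftrightarrow> Q y x" for x y by (rule equiv_relD(2)[OF Q])
  note tr = equiv_relD(3)[OF Q]
  have t: "Q a b \<and> Q a c \<longrightarrow> Q b c" "Q a b \<and> Q b c \<longrightarrow> Q a c" "Q a c \<and> Q b c \<longrightarrow> Q a b"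
    using tr[of b a c] tr[of a b c] tr[of a c b] sym[of a b] sym[of b c] by blast+
  \<comment> \<open>Transitivity excludes exactly two related pairs, which leaves five of the eight
    patterns.\<close>
  then consider "\<not> Q a b" "\<not> Q b c" "\<not> Q a c" | "Q a b" "\<not> Q b c" "\<not> Q a c"
    | "\<not> Q a b" "Q b c" "\<not> Q a c" | "\<not> Q a b" "\<not> Q b c" "Q a c" | "Q a b" "Q b c" "Q a c"
    by blast
  then show ?thesis
  proof cases
    case 1
    then have "Q = join B {}" by (intro J) simp_all
    then show ?thesis by simp
  next
    case 2
    then have "Q = join B {a, b}" by (intro J) (use d in simp_all)
    then show ?thesis by simp
  next
    case 3
    then have "Q = join B {b, c}" by (intro J) (use d in simp_all)
    then show ?thesis by simp
  next
    case 4
    then have "Q = join B {a, c}" by (intro J) (use d in simp_all)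
    then show ?thesis by simp
  next
    case 5
    then have "Q = join B {a, b, c}" by (intro J) simp_all
    then show ?thesis by simp
  qed
qed

section \<open>From anchors of triples to an anchor of the clique\<close>

text \<open>The stars at \<open>a\<close> and at \<open>b\<close> share only the pair
  \<open>{a, b}\<close>, and the diagonal is fixed by \<open>V\<close>. As the relations are
  distinct, they do differ on that pair.\<close>

lemma two_centres_single_pair:
  assumes "equiv_rel V R" "equiv_rel V Q" "agree_off a R Q" "agree_off b R Q" "R \<noteq> Q" "a \<noteq> b"
  shows "R a b \<noteq> Q a b" "R b a \<noteq> Q b a" "{x, y} \<noteq> {a, b} \<Longrightarrow> R x y = Q x y"
proof -
  have *: "R x y = Q x y" if "{x, y} \<noteq> {a, b}" for x y
  proof (cases "x = y")
    case True
    then show ?thesis using equiv_relD(1)[OF assms(1)] equiv_relD(1)[OF assms(2)] by simp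
  next
    case False
    then have "x \<noteq> a \<and> y \<noteq> a \<or> x \<noteq> b \<and> y \<noteq> b"
      using that \<open>a \<noteq> b\<close> by (auto simp: doubleton_eq_iff)
    then show ?thesis using assms(3,4) unfolding agree_off_def by blast
  qed
  have sym: "R a b = R b a" "Q a b = Q b a"
    by (rule equiv_relD(2)[OF assms(1)], rule equiv_relD(2)[OF assms(2)])
  show ab: "R a b \<noteq> Q a b"
  proof
    assume eq: "R a b = Q a b"
    have "R x y = Q x y" for x y
      using *[of x y] eq sym by (metis doubleton_eq_iff)
    then show False using \<open>R \<noteq> Q\<close> by blast
  qed
  then show "R b a \<noteq> Q b a" using sym by simp
  show "R x y = Q x y" if "{x, y} \<noteq> {a, b}" by (rule *[OF that])
qed

lemma agree_off_centre:
  "agree_off u R Q \<Longrightarrow> R x y \<noteq> Q x y \<Longrightarrow> u = x \<or> u = y"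
  unfolding agree_off_def by auto

text \<open>If every triple has an anchor, then the centre sets of the edges at one member pairwise
  intersect. Each has at most two elements, so they either have a common element or form a triangle
  \<open>{a, b}, {b, c}, {a, c}\<close>; in the latter case the three other members have no anchor.\<close>

lemma anchor_if_triples_have_anchors:
  assumes eq: "\<And>R. R \<in> K \<Longrightarrow> equiv_rel V R" and "K \<noteq> {}"
    and H: "\<And>R1 R2 R3. R1 \<in> K \<Longrightarrow> R2 \<in> K \<Longrightarrow> R3 \<in> K \<Longrightarrow>
      \<exists>u\<in>V. agree_off u R1 R2 \<and> agree_off u R2 R3 \<and> agree_off u R3 R1"
  shows "\<exists>u\<in>V. \<forall>R\<in>K. \<forall>Q\<in>K. agree_off u R Q"
proof (rule ccontr)
  assume no: "\<not> ?thesis"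
  obtain R1 where R1: "R1 \<in> K" using \<open>K \<noteq> {}\<close> by blast
  have no1: "\<exists>Q\<in>K. \<not> agree_off u R1 Q" if "u \<in> V" for u
    using no that agree_off_trans agree_off_sym by metis
  have H1: "\<exists>u\<in>V. agree_off u R1 Q \<and> agree_off u R1 Q'" if "Q \<in> K" "Q' \<in> K" for Q Q'
    using H[OF R1 that] agree_off_sym by metis
  \<comment> \<open>If \<open>c\<close> were the only centre of \<open>R1\<close> and
    \<open>Q\<close>, then \<open>H1\<close> would make it a centre of \<open>R1\<close> and every
    other member, hence an anchor.\<close>
  have two: "\<exists>u\<in>V. u \<noteq> c \<and> agree_off u R1 Q" if "Q \<in> K" for Q c
  proof (rule ccontr)
    assume c: "\<not> ?thesis"
    then have "c \<in> V" using H1[OF that that] by metis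
    then obtain Q' where "Q' \<in> K" "\<not> agree_off c R1 Q'" using no1 by blast
    then show False using H1[OF that, of Q'] c by metis
  qed
  \<comment> \<open>An arbitrary vertex, used only to find a member different from
    \<open>R1\<close>.\<close>
  obtain a0 where a0: "a0 \<in> V" using H1[OF R1 R1] by blast
  obtain R2 where R2: "R2 \<in> K" "\<not> agree_off a0 R1 R2" using no1[OF a0] by blast
  have ne2: "R1 \<noteq> R2" using R2 by auto
  obtain a where a: "a \<in> V" "agree_off a R1 R2" using two[OF R2(1)] by blast
  obtain b where b: "b \<in> V" "agree_off b R1 R2" "a \<noteq> b" using two[OF R2(1), of a] by blast
  note p2 = two_centres_single_pair[OF eq[OF R1] eq[OF R2(1)] a(2) b(2) ne2 b(3)]
  have c2: "u = a \<or> u = b" if "agree_off u R1 R2" for u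
    by (rule agree_off_centre[OF that p2(1)])
  obtain R3 where R3: "R3 \<in> K" "\<not> agree_off a R1 R3" using no1[OF a(1)] by blast
  have ne3: "R1 \<noteq> R3" using R3 by auto
  have b3: "agree_off b R1 R3"
    using H1[OF R2(1) R3(1)] c2 R3(2) by blast
  obtain c where c: "c \<in> V" "agree_off c R1 R3" "b \<noteq> c" using two[OF R3(1), of b] by blast
  have ac: "a \<noteq> c" using c R3(2) by blast
  note p3 = two_centres_single_pair[OF eq[OF R1] eq[OF R3(1)] b3 c(2) ne3 c(3)]
  have c3: "u = b \<or> u = c" if "agree_off u R1 R3" for u
    by (rule agree_off_centre[OF that p3(1)])
  obtain R4 where R4: "R4 \<in> K" "\<not> agree_off b R1 R4" using no1[OF b(1)] by blast
  have ne4: "R1 \<noteq> R4" using R4 by auto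
  have a4: "agree_off a R1 R4"
    using H1[OF R2(1) R4(1)] c2 R4(2) by blast
  have c4: "agree_off c R1 R4"
    using H1[OF R3(1) R4(1)] c3 R4(2) by blast
  note p4 = two_centres_single_pair[OF eq[OF R1] eq[OF R4(1)] a4 c4 ne4 ac]
  \<comment> \<open>\<open>R2\<close>, \<open>R3\<close>, \<open>R4\<close> differ from
    \<open>R1\<close> exactly on the pairs \<open>{a, b}\<close>, \<open>{b, c}\<close>,
    \<open>{a, c}\<close>. A common centre would have to be \<open>b\<close> for the first edge and
    \<open>c\<close> for the second.\<close>
  obtain u where u: "agree_off u R2 R3" "agree_off u R3 R4"
    using H[OF R2(1) R3(1) R4(1)] by blast
  have "R2 a b \<noteq> R3 a b" "R2 b c \<noteq> R3 b c" "R3 b c \<noteq> R4 b c" "R3 a c \<noteq> R4 a c"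
    using p2(1) p3(1) p4(1) p2(3)[of b c] p3(3)[of a b] p3(3)[of a c] p4(3)[of b c] b(3) c(3) ac
    by (auto simp: doubleton_eq_iff)
  from agree_off_centre[OF u(1) this(1)] agree_off_centre[OF u(1) this(2)]
    agree_off_centre[OF u(2) this(3)] agree_off_centre[OF u(2) this(4)]
  show False using b(3) c(3) ac by metis
qed

text \<open>Some \<open>x\<close> in \<open>{a, b}\<close> differs from \<open>u\<close>. If
  \<open>u\<close> were not \<open>c\<close>, then \<open>c\<close> would stay related to
  \<open>x\<close> in \<open>Q\<close>, and as the relations agree off \<open>c\<close>, the class
  of \<open>c\<close> would be unchanged, so \<open>R = Q\<close>. A class of only two elements
  would not suffice.\<close>

lemma centre_if_class_of_three:
  assumes e: "equiv_rel V R" "equiv_rel V Q" and cl: "{a, b, c} = {y. R c y}"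
    and d: "a \<noteq> b" "a \<noteq> c" "b \<noteq> c"
    and c: "agree_off c R Q" and u: "agree_off u R Q" and ne: "R \<noteq> Q"
  shows "u = c"
proof (rule ccontr)
  assume uc: "u \<noteq> c"
  obtain x where x: "x \<in> {a, b}" "x \<noteq> u" using d(1) by blast
  then have xc: "x \<noteq> c" using d by blast
  have "R c x" using cl x by blast
  then have "Q c x" using u uc x(2) unfolding agree_off_def by metis
  have "R c y = Q c y" for y
  proof (cases "y = c")
    case True
    then show ?thesis using equiv_relD(1)[OF e(1)] equiv_relD(1)[OF e(2)] by simp
  next
    case False
    have "R c y = R x y" using \<open>R c x\<close> equiv_relD(2,3)[OF e(1)] by metis
    also have "\<dots> = Q x y" using c False xc unfolding agree_off_def by metis
    also have "\<dots> = Q c y" using \<open>Q c x\<close> equiv_relD(2,3)[OF e(2)] by metis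
    finally show ?thesis .
  qed
  then have "R x y = Q x y" for x y
    using c equiv_relD(2)[OF e(1)] equiv_relD(2)[OF e(2)] unfolding agree_off_def by metis
  then show False using ne by blast
qed

section \<open>Cliques\<close>

lemma bell_clique_subset:
  "bell_clique V E k K \<Longrightarrow> K' \<subseteq> K \<Longrightarrow> bell_clique V E k K'"
  unfolding bell_clique_def clique_def by (auto intro: finite_subset)

lemma realizes_sym: "realizes V v P Q \<Longrightarrow> realizes V v Q P"
  unfolding realizes_def by auto

lemma bell_clique_realizes:
  assumes "bell_clique V E k K" "P \<in> K" "Q \<in> K" "P \<noteq> Q"
  shows "\<exists>v. realizes V v P Q"
proof -
  have "{P, Q} \<in> bell_edges V E k"
    using assms unfolding bell_clique_def clique_def by blast
  then obtain P' Q' v where "{P, Q} = {P', Q'}" "realizes V v P' Q'"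
    unfolding bell_edges_def by blast
  then show ?thesis using realizes_sym by (metis doubleton_eq_iff)
qed

lemma bell_clique_verts: "bell_clique V E k K \<Longrightarrow> P \<in> K \<Longrightarrow> P \<in> bell_verts V E k"
  unfolding bell_clique_def by blast

lemma realizes_iff:
  assumes "P \<in> bell_verts V E k" "Q \<in> bell_verts V E k"
  shows "realizes V v P Q \<longleftrightarrow> v \<in> V \<and> P \<noteq> Q \<and> agree_off v (part_rel P) (part_rel Q)"
  unfolding realizes_def del_vertex_eq_iff[OF assms] by blast

lemma S_clique_iff:
  assumes "bell_clique V E k K"
  shows "S_clique V E k K \<longleftrightarrow>
    card K \<le> 1 \<or> (\<exists>u\<in>V. \<forall>P\<in>K. \<forall>Q\<in>K. agree_off u (part_rel P) (part_rel Q))"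
  using assms del_vertex_eq_iff bell_clique_verts[OF assms] unfolding S_clique_def
  by (metis (no_types, lifting))

text \<open>Used contrapositively: a clique that contains a T-clique is a T-clique.\<close>

lemma S_clique_subset:
  assumes "S_clique V E k K" "K' \<subseteq> K"
  shows "S_clique V E k K'"
proof -
  have K: "bell_clique V E k K" using assms(1) unfolding S_clique_def by blast
  then have K': "bell_clique V E k K'" using assms(2) by (rule bell_clique_subset)
  have "card K' \<le> card K" using K assms(2) unfolding bell_clique_def by (simp add: card_mono)
  then show ?thesis
    using assms S_clique_iff[OF K] S_clique_iff[OF K'] by (meson order_trans subsetD)
qed

section \<open>The shape of T-cliques\<close>

text \<open>The first alternative is the cyclic pattern; the other three are the radial ones, with
  the part \<open>{v1, v2, v3}\<close> in \<open>P1\<close>, \<open>P2\<close> and \<open>P3\<close>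
  respectively.\<close>

lemma T_triangle_structure:
  assumes T: "T_clique V E k {P1, P2, P3}"
    and r: "realizes V v3 P1 P2" "realizes V v1 P2 P3" "realizes V v2 P3 P1"
  shows "\<exists>B. isolated3 B v1 v2 v3 \<and>
    ((part_rel P1, part_rel P2, part_rel P3) =
        (join B {v2, v3}, join B {v1, v3}, join B {v1, v2}) \<or>
     (part_rel P1, part_rel P2, part_rel P3) =
        (join B {v1, v2, v3}, join B {v1, v2}, join B {v1, v3}) \<or>
     (part_rel P1, part_rel P2, part_rel P3) =
        (join B {v1, v2}, join B {v1, v2, v3}, join B {v2, v3}) \<or>
     (part_rel P1, part_rel P2, part_rel P3) =
        (join B {v1, v3}, join B {v2, v3}, join B {v1, v2, v3}))"
proof -
  have K: "bell_clique V E k {P1, P2, P3}" using T unfolding T_clique_def by blast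
  note b = bell_clique_verts[OF K]
  have P: "P1 \<in> bell_verts V E k" "P2 \<in> bell_verts V E k" "P3 \<in> bell_verts V E k"
    using b by simp_all
  note R = r(1)[unfolded realizes_iff[OF P(1,2)]] r(2)[unfolded realizes_iff[OF P(2,3)]]
    r(3)[unfolded realizes_iff[OF P(3,1)]]
  have no: "\<not> (agree_off u (part_rel P1) (part_rel P2) \<and> agree_off u (part_rel P2) (part_rel P3) \<and>
      agree_off u (part_rel P3) (part_rel P1))" if "u \<in> V" for u
  proof
    assume "agree_off u (part_rel P1) (part_rel P2) \<and> agree_off u (part_rel P2) (part_rel P3) \<and>
      agree_off u (part_rel P3) (part_rel P1)"
    then have "\<forall>P\<in>{P1, P2, P3}. \<forall>Q\<in>{P1, P2, P3}. agree_off u (part_rel P) (part_rel Q)"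
      using agree_off_sym by fastforce
    then have "S_clique V E k {P1, P2, P3}"
      using S_clique_iff[OF K] that by blast
    then show False using T unfolding T_clique_def by blast
  qed
  show ?thesis
    using triangle_without_anchor[OF P[THEN equiv_rel_part_rel] _ _ _ _ _ _ no] R by blast
qed

lemma T_clique_obtains_T_triangle:
  assumes T: "T_clique V E k K"
  obtains P1 P2 P3 v1 v2 v3 where "P1 \<in> K" "P2 \<in> K" "P3 \<in> K"
    "T_clique V E k {P1, P2, P3}" "P1 \<noteq> P2" "P2 \<noteq> P3" "P3 \<noteq> P1"
    "realizes V v3 P1 P2" "realizes V v1 P2 P3" "realizes V v2 P3 P1"
proof -
  have K: "bell_clique V E k K" and nS: "\<not> S_clique V E k K"
    using T unfolding T_clique_def by blast+
  have fin: "finite K" using K unfolding bell_clique_def by blast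
  have card: "\<not> card K \<le> 1" using nS S_clique_iff[OF K] by blast
  then obtain P Q where PQ: "P \<in> K" "Q \<in> K" "P \<noteq> Q"
    using card_le_Suc0_iff_eq[OF fin] by auto
  then have V: "V \<noteq> {}"
    using bell_clique_realizes[OF K PQ] unfolding realizes_def by blast
  have "\<exists>R1\<in>part_rel ` K. \<exists>R2\<in>part_rel ` K. \<exists>R3\<in>part_rel ` K.
      \<forall>u\<in>V. \<not> (agree_off u R1 R2 \<and> agree_off u R2 R3 \<and> agree_off u R3 R1)"
  proof (rule ccontr)
    assume "\<not> ?thesis"
    then have "\<exists>u\<in>V. \<forall>R\<in>part_rel ` K. \<forall>Q\<in>part_rel ` K. agree_off u R Q"
      using equiv_rel_part_rel[OF bell_clique_verts[OF K]] PQ(1)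
      by (intro anchor_if_triples_have_anchors) blast+
    then show False using nS S_clique_iff[OF K] by blast
  qed
  then obtain P1 P2 P3 where P: "P1 \<in> K" "P2 \<in> K" "P3 \<in> K"
    and no: "\<And>u. u \<in> V \<Longrightarrow> \<not> (agree_off u (part_rel P1) (part_rel P2) \<and>
      agree_off u (part_rel P2) (part_rel P3) \<and> agree_off u (part_rel P3) (part_rel P1))"
    by blast
  have ex: "\<exists>u\<in>V. agree_off u (part_rel P) (part_rel Q)" if "P \<in> K" "Q \<in> K" for P Q
  proof (cases "P = Q")
    case True
    then show ?thesis using V by auto
  next
    case False
    then show ?thesis
      using bell_clique_realizes[OF K that] realizes_iff[OF that[THEN bell_clique_verts[OF K]]]
      by blast
  qed
  \<comment> \<open>If two of the three coincided, a realizer of the remaining edge would be an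
    anchor of the triple.\<close>
  have ne: "P1 \<noteq> P2" "P2 \<noteq> P3" "P3 \<noteq> P1"
    using no ex[OF P(1,2)] ex[OF P(2,3)] ex[OF P(3,1)] agree_off_sym agree_off_refl by metis+
  have K3: "bell_clique V E k {P1, P2, P3}" 
    by (rule bell_clique_subset[OF K]) (use P in simp)
  have "\<not> card {P1, P2, P3} \<le> 1" using ne by simp
  then have "T_clique V E k {P1, P2, P3}"
    using S_clique_iff[OF K3] K3 no unfolding T_clique_def by blast
  then show ?thesis
    using that P ne bell_clique_realizes[OF K] by metis
qed

text \<open>One anchorless triangle fixes \<open>B\<close> and \<open>{a, b, c}\<close> for the
  whole clique: every member is adjacent or equal to its three vertices, which is what
  \<open>agree_off_triangle\<close> needs.\<close>

lemma T_clique_shapes: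
  assumes T: "T_clique V E k K"
  obtains B a b c sh where "isolated3 B a b c" "{a, b, c} \<subseteq> V"
    "\<And>P. P \<in> K \<Longrightarrow> sh P \<in> {{}, {a, b}, {b, c}, {a, c}, {a, b, c}}"
    "\<And>P. P \<in> K \<Longrightarrow> part_rel P = join B (sh P)" "inj_on sh K"
    "\<not> ({} \<in> sh ` K \<and> {a, b, c} \<in> sh ` K)"
proof -
  obtain P1 P2 P3 a b c where P: "P1 \<in> K" "P2 \<in> K" "P3 \<in> K"
    and T3: "T_clique V E k {P1, P2, P3}"
    and r: "realizes V c P1 P2" "realizes V a P2 P3" "realizes V b P3 P1"
    by (rule T_clique_obtains_T_triangle[OF T])
  have K: "bell_clique V E k K" using T unfolding T_clique_def by blast
  note verts = bell_clique_verts[OF K]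
  have V: "{a, b, c} \<subseteq> V" "V \<noteq> {}" using r unfolding realizes_def by auto
  obtain B where iso: "isolated3 B a b c" and S: "(part_rel P1, part_rel P2, part_rel P3) =
        (join B {b, c}, join B {a, c}, join B {a, b}) \<or>
     (part_rel P1, part_rel P2, part_rel P3) =
        (join B {a, b, c}, join B {a, b}, join B {a, c}) \<or>
     (part_rel P1, part_rel P2, part_rel P3) =
        (join B {a, b}, join B {a, b, c}, join B {b, c}) \<or>
     (part_rel P1, part_rel P2, part_rel P3) =
        (join B {a, c}, join B {b, c}, join B {a, b, c})"
    using T_triangle_structure[OF T3 r] by blast
  note d = isolated3D(1-3)[OF iso]
  define F where "F = {S. S \<subseteq> {a, b, c} \<and> (\<exists>P\<in>K. part_rel P = join B S)}"
  have F: "F \<subseteq> Pow {a, b, c}" "\<And>S. S \<in> F \<Longrightarrow> \<exists>P\<in>K. part_rel P = join B S"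
    unfolding F_def by blast+
  have mem: "S \<in> F" if "P \<in> K" "part_rel P = join B S" "S \<subseteq> {a, b, c}" for P S
    using that unfolding F_def by blast
  note mem = mem[OF P(1)] mem[OF P(2)] mem[OF P(3)]
  obtain G where GF: "G \<subseteq> F" and G: "G = {{b, c}, {a, c}, {a, b}} \<or> G = {{a, b, c}, {a, b}, {a, c}} \<or>
     G = {{a, b}, {a, b, c}, {b, c}} \<or> G = {{a, c}, {b, c}, {a, b, c}}"
    using S
  proof (elim disjE Pair_inject, goal_cases)
    case 1
    have "{{b, c}, {a, c}, {a, b}} \<subseteq> F" using mem 1(2-4) by simp
    then show ?case by (rule 1(1)) simp
  next
    case 2
    have "{{a, b, c}, {a, b}, {a, c}} \<subseteq> F" using mem 2(2-4) by simp
    then show ?case by (rule 2(1)) simp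
  next
    case 3
    have "{{a, b}, {a, b, c}, {b, c}} \<subseteq> F" using mem 3(2-4) by simp
    then show ?case by (rule 3(1)) simp
  next
    case 4
    have "{{a, c}, {b, c}, {a, b, c}} \<subseteq> F" using mem 4(2-4) by simp
    then show ?case by (rule 4(1)) simp
  qed
  have pairs: "(\<exists>S\<in>F. x \<in> S \<and> y \<in> S) \<and> (\<exists>S\<in>F. \<not> (x \<in> S \<and> y \<in> S))"
    if "x \<in> {a, b, c}" "y \<in> {a, b, c}" "x \<noteq> y" for x y
  proof -
    \<comment> \<open>Each pair lies inside exactly two of the sets \<open>{a, b}\<close>,
      \<open>{b, c}\<close>, \<open>{a, c}\<close>, \<open>{a, b, c}\<close>, so any three of them
      include one that contains it and one that does not.\<close>
    have "(\<exists>S\<in>G. x \<in> S \<and> y \<in> S) \<and> (\<exists>S\<in>G. \<not> (x \<in> S \<and> y \<in> S))"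
      using G that d by (elim disjE) auto
    then show ?thesis using GF by blast
  qed
  obtain S1 where "S1 \<in> F" using GF G by auto
  then obtain P0 where S1: "S1 \<subseteq> {a, b, c}" "P0 \<in> K" "part_rel P0 = join B S1"
    unfolding F_def by blast
  have B: "B x x \<longleftrightarrow> x \<in> V" for x
    using equiv_relD(1)[OF equiv_rel_part_rel[OF verts[OF S1(2)]], of x] S1(1,3)
      isolated3D(4)[OF iso, of x x] unfolding join_def by auto
  have near: "\<exists>u. agree_off u (part_rel P) (part_rel Q)" if "P \<in> K" "Q \<in> K" for P Q
  proof (cases "P = Q")
    case False
    then show ?thesis
      using bell_clique_realizes[OF K that] realizes_iff[OF verts verts] that by blast
  qed simp
  have "\<exists>S\<in>{{}, {a, b}, {b, c}, {a, c}, {a, b, c}}. part_rel P = join B S" if "P \<in> K" for P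
  proof (rule agree_off_triangle[OF equiv_rel_part_rel[OF verts[OF that]] iso V(1) B F(1) _ pairs])
    show "\<exists>u. agree_off u (part_rel P) (join B S)" if "S \<in> F" for S
      using F(2)[OF that] near[OF \<open>P \<in> K\<close>] by metis
  qed
  then obtain sh where sh: "\<And>P. P \<in> K \<Longrightarrow> sh P \<in> {{}, {a, b}, {b, c}, {a, c}, {a, b, c}}"
    "\<And>P. P \<in> K \<Longrightarrow> part_rel P = join B (sh P)"
    by metis
  have "inj_on sh K"
    using sh(2) part_rel_inject[OF verts verts] unfolding inj_on_def by metis
  \<comment> \<open>These two shapes differ on all three pairs, and no vertex lies on all of
    them.\<close>
  moreover have "\<not> ({} \<in> sh ` K \<and> {a, b, c} \<in> sh ` K)"
  proof
    assume "{} \<in> sh ` K \<and> {a, b, c} \<in> sh ` K"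
    then obtain P Q where "P \<in> K" "Q \<in> K" "sh P = {}" "sh Q = {a, b, c}" by (metis imageE)
    then obtain u where "agree_off u (join B {}) (join B {a, b, c})"
      using near[of P Q] sh(2) by metis
    then show False using d by (simp add: agree_off_join_iff[OF iso]) metis
  qed
  ultimately show ?thesis using that iso V(1) sh by blast
qed

section \<open>Identification of tetrahedra and triangles\<close>

lemma nsets_3_of_4:
  assumes "card K = 4"
  shows "[K]\<^bsup>3\<^esup> = (\<lambda>P. K - {P}) ` K"
proof
  have fin: "finite K" using assms card.infinite by fastforce
  show "(\<lambda>P. K - {P}) ` K \<subseteq> [K]\<^bsup>3\<^esup>"
    using assms fin by (auto simp: nsets_def)
  show "[K]\<^bsup>3\<^esup> \<subseteq> (\<lambda>P. K - {P}) ` K"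
  proof
    fix T assume "T \<in> [K]\<^bsup>3\<^esup>"
    then have T: "T \<subseteq> K" "card T = 3" "finite T" by (auto simp: nsets_def)
    then have "card (K - T) = 1" using assms by (simp add: card_Diff_subset)
    then obtain P where "K - T = {P}" by (rule card_1_singletonE)
    then have "T = K - {P}" "P \<in> K" using T(1) by blast+
    then show "T \<in> (\<lambda>P. K - {P}) ` K" by blast
  qed
qed

text \<open>The shapes embed \<open>K\<close> into five sets, two of which exclude each other. With
  at least four members, \<open>K\<close> realizes all four shapes of one of two families, and its
  triangles can be inspected by the member they omit.\<close>

lemma T_clique_not_triangle:
  assumes T: "T_clique V E k K" and "card K \<noteq> 3"
  shows "card K = 4 \<and> (split_T_tetrahedron V E k K \<or> fused_T_tetrahedron V E k K)"
proof -
  have K: "bell_clique V E k K" using T unfolding T_clique_def by blast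
  then have fin: "finite K" unfolding bell_clique_def by blast
  obtain P1 P2 P3 where "P1 \<in> K" "P2 \<in> K" "P3 \<in> K" "P1 \<noteq> P2" "P2 \<noteq> P3" "P3 \<noteq> P1"
    by (rule T_clique_obtains_T_triangle[OF T])
  then have "{P1, P2, P3} \<subseteq> K" "card {P1, P2, P3} = 3" by auto
  then have "3 \<le> card K" using card_mono[OF fin] by metis
  then have ge: "4 \<le> card K" using assms(2) by linarith
  obtain B a b c sh where iso: "isolated3 B a b c" and V: "{a, b, c} \<subseteq> V"
    and sh: "\<And>P. P \<in> K \<Longrightarrow> sh P \<in> {{}, {a, b}, {b, c}, {a, c}, {a, b, c}}"
      "\<And>P. P \<in> K \<Longrightarrow> part_rel P = join B (sh P)"
    and inj: "inj_on sh K" and not_both: "\<not> ({} \<in> sh ` K \<and> {a, b, c} \<in> sh ` K)"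
    using T_clique_shapes[OF T] by blast
  note d = isolated3D(1-3)[OF iso]
  define ab bc ac abc where shapes: "ab = {a, b}" "bc = {b, c}" "ac = {a, c}" "abc = {a, b, c}"
  have ds: "ab \<noteq> bc" "ab \<noteq> ac" "bc \<noteq> ac"
    "ab \<noteq> abc" "bc \<noteq> abc" "ac \<noteq> abc"
    unfolding shapes using d by auto
  have ne: "ab \<noteq> {}" "bc \<noteq> {}" "ac \<noteq> {}" unfolding shapes by simp_all
  let ?fused = "{ab, bc, ac, abc}" and ?split = "{{}, ab, bc, ac}"
  have card4: "card ?fused = 4" "card ?split = 4"
    using ds ne by (simp_all add: card_insert_if)
  have cardsh: "card (sh ` K) = card K" by (rule card_image[OF inj])
  have "sh ` K \<subseteq> insert {} ?fused" "sh ` K \<subseteq> insert abc ?split"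
    using sh(1)[folded shapes] by blast+
  then have "sh ` K \<subseteq> ?fused \<or> sh ` K \<subseteq> ?split"
    using not_both[folded shapes] by (metis subset_insert)
  then have shK: "sh ` K = ?fused \<or> sh ` K = ?split"
  proof (elim disjE)
    assume sub: "sh ` K \<subseteq> ?fused"
    have "sh ` K = ?fused"
      by (rule card_seteq[OF _ sub]) (use ge card4 cardsh in simp_all)
    then show ?thesis ..
  next
    assume sub: "sh ` K \<subseteq> ?split"
    have "sh ` K = ?split"
      by (rule card_seteq[OF _ sub]) (use ge card4 cardsh in simp_all)
    then show ?thesis ..
  qed
  then have four: "card K = 4" using cardsh card4 by metis
  have S_iff: "S_clique V E k (K - {P}) \<longleftrightarrow>
      (\<exists>u\<in>V. \<forall>S\<in>sh ` K - {sh P}. \<forall>S'\<in>sh ` K - {sh P}. agree_off u (join B S) (join B S'))"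
    if "P \<in> K" for P
  proof -
    have K': "bell_clique V E k (K - {P})" by (rule bell_clique_subset[OF K]) blast
    have im: "sh ` K - {sh P} = sh ` (K - {P})"
      using inj_on_image_set_diff[OF inj, of K "{P}"] that by simp
    have "card (K - {P}) = 3" using that four fin by simp
    then have "S_clique V E k (K - {P}) \<longleftrightarrow>
        (\<exists>u\<in>V. \<forall>Q\<in>K - {P}. \<forall>Q'\<in>K - {P}. agree_off u (part_rel Q) (part_rel Q'))"
      using S_clique_iff[OF K'] by simp
    then show ?thesis unfolding im by (simp add: sh(2))
  qed
  have T_iff: "T_clique V E k (K - {P}) \<longleftrightarrow> \<not> S_clique V E k (K - {P})" for P
    using bell_clique_subset[OF K, of "K - {P}"] unfolding T_clique_def by blast
  \<comment> \<open>Two such shapes differ on exactly two pairs, whose common vertex is the only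
    possible centre.\<close>
  have centre: "agree_off u (join B ab) (join B bc) \<Longrightarrow> u = b"
    "agree_off u (join B bc) (join B ac) \<Longrightarrow> u = c"
    "agree_off u (join B ab) (join B ac) \<Longrightarrow> u = a"
    "agree_off u (join B ab) (join B abc) \<Longrightarrow> u = c"
    "agree_off u (join B bc) (join B abc) \<Longrightarrow> u = a" for u
    using d unfolding shapes by (auto simp: agree_off_join_iff[OF iso])
  have not_S: "\<not> S_clique V E k (K - {P})"
    if "P \<in> K" "X \<in> sh ` K - {sh P}" "Y \<in> sh ` K - {sh P}" "Z \<in> sh ` K - {sh P}"
      "\<And>u. agree_off u (join B X) (join B Y) \<Longrightarrow> u = x"
      "\<And>u. agree_off u (join B X) (join B Z) \<Longrightarrow> u = z" "x \<noteq> z" for P X Y Z x z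
    using that S_iff[OF that(1)] by metis
  have inj_del: "inj_on (\<lambda>P. K - {P}) K" by (auto simp: inj_on_def)
  from shK show ?thesis
  proof
    assume eq: "sh ` K = ?fused"
    have "\<not> S_clique V E k (K - {P})" if P: "P \<in> K" for P
    proof -
      have "sh P \<in> ?fused" using P eq by blast
      then consider "sh P = ab" | "sh P = bc" | "sh P = ac" | "sh P = abc"
        by blast
      then show ?thesis
      proof cases
        case 1
        then show ?thesis
          by (intro not_S[OF P, of "bc" "ac" "abc" c a]) (use eq ds ne d centre in simp_all)
      next
        case 2
        then show ?thesis
          by (intro not_S[OF P, of "ab" "ac" "abc" a c]) (use eq ds ne d centre in simp_all)
      next
        case 3
        then show ?thesis
          by (intro not_S[OF P, of "ab" "bc" "abc" b c]) (use eq ds ne d centre in simp_all)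
      next
        case 4
        then show ?thesis
          by (intro not_S[OF P, of "ab" "bc" "ac" b a]) (use eq ds ne d centre in simp_all)
      qed
    qed
    then have "fused_T_tetrahedron V E k K"
      using K four T_iff unfolding fused_T_tetrahedron_def nsets_3_of_4[OF four] by blast
    then show ?thesis using four by blast
  next
    assume eq: "sh ` K = ?split"
    have S: "S_clique V E k (K - {P}) \<longleftrightarrow> sh P \<noteq> {}" if P: "P \<in> K" for P
    proof -
      have "sh P \<in> ?split" using P eq by blast
      then consider "sh P = {}" | "sh P = ab" | "sh P = bc" | "sh P = ac"
        by blast
      then show ?thesis
      proof cases
        case 1
        then have "\<not> S_clique V E k (K - {P})"
          by (intro not_S[OF P, of "ab" "bc" "ac" b a]) (use eq ds ne d centre in simp_all)
        then show ?thesis using 1 by simp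
      next
        case 2
        \<comment> \<open>Once \<open>ab\<close> is omitted, no shape relates \<open>a\<close> and
          \<open>b\<close>, so every difference meets \<open>c\<close>, which is an anchor. The next
          two cases are symmetric.\<close>
        then have "sh ` K - {sh P} = {{}, bc, ac}" using eq ds ne by auto
        then have "S_clique V E k (K - {P})"
          unfolding S_iff[OF P] shapes using V
          by (intro bexI[of _ c]) (simp_all add: agree_off_join_iff[OF iso] d d[symmetric])
        then show ?thesis using 2 ne by simp
      next
        case 3
        then have "sh ` K - {sh P} = {{}, ab, ac}" using eq ds ne by auto
        then have "S_clique V E k (K - {P})"
          unfolding S_iff[OF P] shapes using V
          by (intro bexI[of _ a]) (simp_all add: agree_off_join_iff[OF iso] d d[symmetric])
        then show ?thesis using 3 ne by simp
      next
        case 4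
        then have "sh ` K - {sh P} = {{}, ab, bc}" using eq ds ne by auto
        then have "S_clique V E k (K - {P})"
          unfolding S_iff[OF P] shapes using V
          by (intro bexI[of _ b]) (simp_all add: agree_off_join_iff[OF iso] d d[symmetric])
        then show ?thesis using 4 ne by simp
      qed
    qed
    \<comment> \<open>The member whose relation is \<open>B\<close> itself lies in all three
      S-triangles; omitting it leaves the only T-triangle.\<close>
    obtain P0 where P0: "P0 \<in> K" "sh P0 = {}" using eq by (metis imageE insertI1)
    have P0_iff: "sh P = {} \<longleftrightarrow> P = P0" if "P \<in> K" for P
      using inj P0 that unfolding inj_on_def by metis
    have "{T \<in> [K]\<^bsup>3\<^esup>. S_clique V E k T} = (\<lambda>P. K - {P}) ` (K - {P0})"
      unfolding nsets_3_of_4[OF four] using S P0_iff by blast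
    moreover have "card ((\<lambda>P. K - {P}) ` (K - {P0})) = card (K - {P0})"
      by (rule card_image) (rule inj_on_subset[OF inj_del], blast)
    moreover have "card (K - {P0}) = 3" using P0(1) four fin by simp
    moreover have "{T \<in> [K]\<^bsup>3\<^esup>. T_clique V E k T} = {K - {P0}}"
      unfolding nsets_3_of_4[OF four] using S P0_iff P0 T_iff by blast
    ultimately have "split_T_tetrahedron V E k K"
      using K four unfolding split_T_tetrahedron_def by simp
    then show ?thesis using four by blast
  qed
qed

text \<open>The required parts are classes of the relations found in
  \<open>T_triangle_structure\<close>. In the last two patterns the labels are rotated so that the
  member with the three-element part comes first.\<close>

lemma T_clique_triangle:
  assumes T: "T_clique V E k K" and "card K = 3"
  shows "cyclic_T_triangle V E k K \<or> radial_T_triangle V E k K"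
proof -
  have K: "bell_clique V E k K" using T unfolding T_clique_def by blast
  then have fin: "finite K" unfolding bell_clique_def by blast
  obtain P1 P2 P3 v1 v2 v3 where P: "P1 \<in> K" "P2 \<in> K" "P3 \<in> K" "P1 \<noteq> P2" "P2 \<noteq> P3" "P3 \<noteq> P1"
    and T3: "T_clique V E k {P1, P2, P3}"
    and r: "realizes V v3 P1 P2" "realizes V v1 P2 P3" "realizes V v2 P3 P1"
    by (rule T_clique_obtains_T_triangle[OF T])
  have "{P1, P2, P3} \<subseteq> K" "card {P1, P2, P3} = 3" using P by auto
  then have Keq: "K = {P1, P2, P3}" using card_seteq[OF fin, of "{P1, P2, P3}"] assms(2) by simp
  obtain B where iso: "isolated3 B v1 v2 v3" and S: "(part_rel P1, part_rel P2, part_rel P3) =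
        (join B {v2, v3}, join B {v1, v3}, join B {v1, v2}) \<or>
     (part_rel P1, part_rel P2, part_rel P3) =
        (join B {v1, v2, v3}, join B {v1, v2}, join B {v1, v3}) \<or>
     (part_rel P1, part_rel P2, part_rel P3) =
        (join B {v1, v2}, join B {v1, v2, v3}, join B {v2, v3}) \<or>
     (part_rel P1, part_rel P2, part_rel P3) =
        (join B {v1, v3}, join B {v2, v3}, join B {v1, v2, v3})"
    using T_triangle_structure[OF T3 r] by blast
  note d = isolated3D(1-3)[OF iso]
  note mem = part_mem_iff[OF bell_clique_verts[OF K]]
  have B: "B v1 y \<longleftrightarrow> y = v1" "B v2 y \<longleftrightarrow> y = v2" "B v3 y \<longleftrightarrow> y = v3" for y
    using isolated3D(4)[OF iso] by simp_all
  have radialI: "radial_T_triangle V E k K"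
    if "K = {Q1, Q2, Q3}" "w1 \<noteq> w2" "w2 \<noteq> w3" "w1 \<noteq> w3" "realizes V w3 Q1 Q2" "realizes V w1 Q2 Q3"
      "realizes V w2 Q3 Q1" "{w1, w2, w3} \<in># Q1" for Q1 Q2 Q3 w1 w2 w3
    unfolding radial_T_triangle_def using K assms(2) that by blast
  from S show ?thesis
  proof (elim disjE Pair_inject, goal_cases)
    case 1
    have "{v1} \<in># P1" "{v2} \<in># P2" "{v3} \<in># P3"
      using mem[OF P(1), of v1 "{v1}"] mem[OF P(2), of v2 "{v2}"] mem[OF P(3), of v3 "{v3}"]
        1 d by (auto simp: join_def B)
    then have "cyclic_T_triangle V E k K"
      unfolding cyclic_T_triangle_def using T assms(2) Keq d r by blast
    then show ?case ..
  next
    case 2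
    have "{v1, v2, v3} \<in># P1"
      using mem[OF P(1), of v1 "{v1, v2, v3}"] 2 by (auto simp: join_def B)
    then have "radial_T_triangle V E k K"
      by (intro radialI[OF Keq d r])
    then show ?case ..
  next
    case 3
    have "{v2, v3, v1} \<in># P2"
      using mem[OF P(2), of v2 "{v2, v3, v1}"] 3 by (auto simp: join_def B)
    moreover have "K = {P2, P3, P1}" using Keq by blast
    ultimately have "radial_T_triangle V E k K"
      by (intro radialI[OF _ d(2) _ _ r(2,3,1)]) (use d in auto)
    then show ?case ..
  next
    case 4
    have "{v3, v1, v2} \<in># P3"
      using mem[OF P(3), of v3 "{v3, v1, v2}"] 4 by (auto simp: join_def B)
    moreover have "K = {P3, P1, P2}" using Keq by blast
    ultimately have "radial_T_triangle V E k K"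
      by (intro radialI[OF _ _ d(1) _ r(3,1,2)]) (use d in auto)
    then show ?case ..
  qed
qed

section \<open>Mutual exclusion of the five types\<close>

text \<open>By \<open>centre_if_class_of_three\<close>, the two edges at \<open>P1\<close> have
  \<open>v3\<close> and \<open>v2\<close> as their only realizers, so no anchor exists.\<close>

lemma radial_T_clique:
  assumes "radial_T_triangle V E k K"
  shows "T_clique V E k K"
proof -
  obtain P1 P2 P3 v1 v2 v3 where K: "bell_clique V E k K" "card K = 3" "K = {P1, P2, P3}"
    and d: "v1 \<noteq> v2" "v2 \<noteq> v3" "v1 \<noteq> v3"
    and r: "realizes V v3 P1 P2" "realizes V v2 P3 P1" and m: "{v1, v2, v3} \<in># P1"
    using assms unfolding radial_T_triangle_def by blast
  have P: "P1 \<in> bell_verts V E k" "P2 \<in> bell_verts V E k" "P3 \<in> bell_verts V E k"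
    using bell_clique_verts[OF K(1)] K(3) by simp_all
  note e = P[THEN equiv_rel_part_rel]
  have c2: "{v1, v3, v2} = {y. part_rel P1 v2 y}" and c3: "{v1, v2, v3} = {y. part_rel P1 v3 y}"
    using part_mem_iff[OF P(1), of v2 "{v1, v2, v3}"] part_mem_iff[OF P(1), of v3 "{v1, v2, v3}"] m
    by (auto simp: insert_commute)
  have "\<not> S_clique V E k K"
  proof
    assume "S_clique V E k K"
    then obtain u where "agree_off u (part_rel P1) (part_rel P2)" "agree_off u (part_rel P1) (part_rel P3)"
      using S_clique_iff[OF K(1)] K(2,3) by auto
    then have "u = v3" "u = v2"
      using centre_if_class_of_three[OF e(1,2) c3 d(1,3,2)]
        centre_if_class_of_three[OF e(1,3) c2 d(3,1) d(2)[symmetric]]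
        r(1)[unfolded realizes_iff[OF P(1,2)]] r(2)[THEN realizes_sym, unfolded realizes_iff[OF P(1,3)]]
        part_rel_inject[OF P(1,2)] part_rel_inject[OF P(1,3)]
      by blast+
    then show False using d by simp
  qed
  then show ?thesis using K(1) unfolding T_clique_def by blast
qed

text \<open>In a cyclic triangle the edge opposite to each member has a unique realizer, which is a
  singleton part of that member. For \<open>Q1\<close> this realizer is \<open>w1\<close>, so
  \<open>{w1}\<close> and \<open>{w1, w2, w3}\<close> would both be parts of
  \<open>Q1\<close>.\<close>

lemma cyclic_not_radial:
  assumes cyc: "cyclic_T_triangle V E k K" and rad: "radial_T_triangle V E k K"
  shows False
proof -
  obtain P1 P2 P3 v1 v2 v3 where T: "T_clique V E k K" and Keq: "K = {P1, P2, P3}"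
    and v: "v1 \<noteq> v2" "v2 \<noteq> v3" "v1 \<noteq> v3"
    and r: "realizes V v3 P1 P2" "realizes V v1 P2 P3" "realizes V v2 P3 P1"
    and m: "{v1} \<in># P1" "{v2} \<in># P2" "{v3} \<in># P3"
    using cyc unfolding cyclic_T_triangle_def by blast
  obtain Q1 Q2 Q3 w1 w2 w3 where Keq': "K = {Q1, Q2, Q3}"
    and w: "w1 \<noteq> w2" and Q: "realizes V w3 Q1 Q2" "realizes V w1 Q2 Q3" "realizes V w2 Q3 Q1"
    and m': "{w1, w2, w3} \<in># Q1"
    using rad unfolding radial_T_triangle_def by blast
  have K: "bell_clique V E k K" using T unfolding T_clique_def by blast
  have P: "P1 \<in> bell_verts V E k" "P2 \<in> bell_verts V E k" "P3 \<in> bell_verts V E k"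
    using bell_clique_verts[OF K] Keq by simp_all
  obtain B where iso: "isolated3 B v1 v2 v3" and S: "(part_rel P1, part_rel P2, part_rel P3) =
        (join B {v2, v3}, join B {v1, v3}, join B {v1, v2}) \<or>
     (part_rel P1, part_rel P2, part_rel P3) =
        (join B {v1, v2, v3}, join B {v1, v2}, join B {v1, v3}) \<or>
     (part_rel P1, part_rel P2, part_rel P3) =
        (join B {v1, v2}, join B {v1, v2, v3}, join B {v2, v3}) \<or>
     (part_rel P1, part_rel P2, part_rel P3) =
        (join B {v1, v3}, join B {v2, v3}, join B {v1, v2, v3})"
    using T_triangle_structure[OF T[unfolded Keq] r] by blast
  \<comment> \<open>The singleton parts exclude the radial patterns: the first two of these relate
    \<open>v1\<close> and \<open>v2\<close> in \<open>P1\<close>, the last relates \<open>v3\<close>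
    and \<open>v1\<close> in \<open>P3\<close>.\<close>
  have "\<not> part_rel P1 v1 v2" "\<not> part_rel P2 v2 v1" "\<not> part_rel P3 v3 v1"
    using part_mem_iff[OF P(1), of v1 "{v1}"] part_mem_iff[OF P(2), of v2 "{v2}"]
      part_mem_iff[OF P(3), of v3 "{v3}"] m v by auto
  with S have R: "part_rel P1 = join B {v2, v3}" "part_rel P2 = join B {v1, v3}"
    "part_rel P3 = join B {v1, v2}"
    by (auto simp: join_def)
  have centre: "agree_off w (part_rel P1) (part_rel P2) \<Longrightarrow> w = v3"
    "agree_off w (part_rel P2) (part_rel P3) \<Longrightarrow> w = v1"
    "agree_off w (part_rel P3) (part_rel P1) \<Longrightarrow> w = v2" for w
    unfolding R using v by (auto simp: agree_off_join_iff[OF iso])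
  have uniq: "realizes V w P1 P2 \<Longrightarrow> w = v3" "realizes V w P2 P3 \<Longrightarrow> w = v1"
    "realizes V w P3 P1 \<Longrightarrow> w = v2" for w
    using centre by (simp_all add: realizes_iff[OF P(1,2)] realizes_iff[OF P(2,3)] realizes_iff[OF P(3,1)])
  have single: "{w1, w2, w3} \<notin># P" if "P \<in> bell_verts V E k" "{w1} \<in># P" for P
    using part_mem_iff[OF that(1), of w1 "{w1}"] part_mem_iff[OF that(1), of w1 "{w1, w2, w3}"]
      that(2) w by auto
  have ne: "Q1 \<noteq> Q2" "Q2 \<noteq> Q3" "Q3 \<noteq> Q1" using Q unfolding realizes_def by blast+
  have Q123: "Q1 \<in> {P1, P2, P3}" "Q2 \<in> {P1, P2, P3}" "Q3 \<in> {P1, P2, P3}"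
    unfolding Keq[symmetric] Keq' by simp_all
  from Q123(1) consider "Q1 = P1" | "Q1 = P2" | "Q1 = P3" by blast
  then show False
  proof cases
    case 1
    then have "Q2 = P2 \<and> Q3 = P3 \<or> Q2 = P3 \<and> Q3 = P2" using Q123(2,3) ne by auto
    then have "w1 = v1" using Q(2) uniq(2) realizes_sym by metis
    then show False using single[OF P(1)] m(1) m' 1 by simp
  next
    case 2
    then have "Q2 = P1 \<and> Q3 = P3 \<or> Q2 = P3 \<and> Q3 = P1" using Q123(2,3) ne by auto
    then have "w1 = v2" using Q(2) uniq(3) realizes_sym by metis
    then show False using single[OF P(2)] m(2) m' 2 by simp
  next
    case 3
    then have "Q2 = P1 \<and> Q3 = P2 \<or> Q2 = P2 \<and> Q3 = P1" using Q123(2,3) ne by auto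
    then have "w1 = v3" using Q(2) uniq(1) realizes_sym by metis
    then show False using single[OF P(3)] m(3) m' 3 by simp
  qed
qed

text \<open>A single T-triangle inside \<open>K\<close> already prevents an anchor. No triangle is
  an S-clique here, whereas a split tetrahedron has three that are.\<close>

lemma fused_T_clique:
  assumes "fused_T_tetrahedron V E k K"
  shows "T_clique V E k K" "\<not> split_T_tetrahedron V E k K"
proof -
  have K: "bell_clique V E k K" "card K = 4" and T: "\<And>T. T \<in> [K]\<^bsup>3\<^esup> \<Longrightarrow> T_clique V E k T"
    using assms unfolding fused_T_tetrahedron_def by blast+
  have "K \<noteq> {}" using K(2) by auto
  then obtain T where T3: "T \<in> [K]\<^bsup>3\<^esup>" unfolding nsets_3_of_4[OF K(2)] by blast
  then have "T \<subseteq> K" by (simp add: nsets_def)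
  then show "T_clique V E k K"
    using T[OF T3] S_clique_subset K(1) unfolding T_clique_def by blast
  have "{T \<in> [K]\<^bsup>3\<^esup>. S_clique V E k T} = {}" using T unfolding T_clique_def by blast
  then have "card {T \<in> [K]\<^bsup>3\<^esup>. S_clique V E k T} = 0" by (simp only: card.empty)
  then show "\<not> split_T_tetrahedron V E k K" unfolding split_T_tetrahedron_def by simp
qed

lemma split_T_clique:
  assumes "split_T_tetrahedron V E k K"
  shows "T_clique V E k K"
proof -
  have K: "bell_clique V E k K" and "card {T \<in> [K]\<^bsup>3\<^esup>. T_clique V E k T} = 1"
    using assms unfolding split_T_tetrahedron_def by blast+
  then obtain T where "{T \<in> [K]\<^bsup>3\<^esup>. T_clique V E k T} = {T}" 
    using card_1_singletonE by blast
  then have "T \<in> [K]\<^bsup>3\<^esup>" "T_clique V E k T" by blast+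
  then show ?thesis
    using S_clique_subset K unfolding T_clique_def nsets_def by blast
qed

text \<open>Uniqueness concerns positions in the list, so two true entries violate it although they
  are equal as values.\<close>

lemma exactly_one_5_iff:
  "exactly_one [p, q, r, s, t] \<longleftrightarrow> (p \<or> q \<or> r \<or> s \<or> t) \<and>
    \<not> (p \<and> q) \<and> \<not> (p \<and> r) \<and> \<not> (p \<and> s) \<and> \<not> (p \<and> t) \<and> \<not> (q \<and> r) \<and> \<not> (q \<and> s) \<and>
    \<not> (q \<and> t) \<and> \<not> (r \<and> s) \<and> \<not> (r \<and> t) \<and> \<not> (s \<and> t)"
proof -
  have "exactly_one [p, q, r, s, t] \<longleftrightarrow>
      (\<exists>i<5. [p, q, r, s, t] ! i \<and> (\<forall>j<5. [p, q, r, s, t] ! j \<longrightarrow> j = i))"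
    unfolding exactly_one_def Ex1_def by (auto simp: eval_nat_numeral)
  also have "\<dots> \<longleftrightarrow> (p \<or> q \<or> r \<or> s \<or> t) \<and>
    \<not> (p \<and> q) \<and> \<not> (p \<and> r) \<and> \<not> (p \<and> s) \<and> \<not> (p \<and> t) \<and> \<not> (q \<and> r) \<and> \<not> (q \<and> s) \<and>
    \<not> (q \<and> t) \<and> \<not> (r \<and> s) \<and> \<not> (r \<and> t) \<and> \<not> (s \<and> t)"
    by (cases p; cases q; cases r; cases s; cases t)
      (simp_all add: eval_nat_numeral Ex_less_Suc2 All_less_Suc2)
  finally show ?thesis .
qed

theorem theorem3p8:
  fixes V :: "'a set" and E :: "'a set set" and k m :: nat
    and K :: "'a set multiset set"
  assumes "simple_graph V E"
    and "k \<ge> 1"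
    and "bell_clique V E k K"
    and "card K = m"
    and "m \<ge> 1"
  shows "exactly_one
    [m = 3 \<and> cyclic_T_triangle V E k K,
     m = 3 \<and> radial_T_triangle V E k K,
     m = 4 \<and> split_T_tetrahedron V E k K,
     m = 4 \<and> fused_T_tetrahedron V E k K,
     S_clique V E k K]"
proof -
  let ?c = "cyclic_T_triangle V E k K" and ?r = "radial_T_triangle V E k K"
    and ?s = "split_T_tetrahedron V E k K" and ?f = "fused_T_tetrahedron V E k K"
    and ?S = "S_clique V E k K"
  have T: "T_clique V E k K \<longleftrightarrow> \<not> ?S" using assms(3) unfolding T_clique_def by blast
  have "\<not> ?S \<longrightarrow> m = 3 \<and> (?c \<or> ?r) \<or> m = 4 \<and> (?s \<or> ?f)"
    using T_clique_triangle T_clique_not_triangle T assms(4) by blast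
  moreover have "?c \<or> ?r \<or> ?s \<or> ?f \<longrightarrow> \<not> ?S"
    using radial_T_clique fused_T_clique(1) split_T_clique T unfolding cyclic_T_triangle_def by blast
  moreover have "\<not> (?c \<and> ?r)" using cyclic_not_radial by blast
  moreover have "\<not> (?s \<and> ?f)" using fused_T_clique(2) by blast
  \<comment> \<open>A triangle case and a tetrahedron case exclude each other by the value of
    \<open>m\<close>.\<close>
  ultimately show ?thesis unfolding exactly_one_5_iff by auto
qed

end
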